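(* Let $\alpha\in\mathbb{N}$, and let $\Xi\subset\mathbb{R}$ be finite, non-empty and symmetric. Then there always exists an optimal shift rule (for $\Xi,\alpha$) whose support has size at most $|\Xi|-(\alpha\bmod 2)$.
   Context: $\mathbb{N}=\{1,2,3,\dots\}$. A set $\Xi\subset\mathbb{R}$ is symmetric if $\Xi=-\Xi$. $\alpha\bmod2\in\{0,1\}$ is the remainder of $\alpha$ upon division by $2$. $\mathscr{K}_\Xi$ denotes the real vector space of functions $f\colon\mathbb{R}\to\mathbb{R}$ of the form $f(x)=\sum_{\xi\in\Xi}b_\xi e^{2\pi i\,\xi x}$ with $b\in\mathbb{C}^\Xi$, $b_{-\xi}=\overline{b_\xi}$. $\partial^\alpha$ is the $\alpha$-th derivative. A (finite) shift rule is a real signed measure of finite support $\phi=\sum_{a\in A}u_a\delta_a$, with $A\subset\mathbb{R}$ finite and $u\in\mathbb{R}^A$; it acts by $(\phi*f)(x)=\sum_{a\in A}u_af(x-a)$. Its cost is $\|\phi\|_1=\sum_{a\in A}|u_a|$. It is feasible for $\Xi,\alpha$ if $\phi*g=\partial^\alpha g$ for all $g\in\mathscr{K}_\Xi$. It is optimal if it is feasible and its cost equals the infimum of the costs of all finite feasible shift rules. *)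

theory Defs
  imports Complex_Main "HOL-Analysis.Derivative" "HOL-Library.Poly_Mapping"
begin

definition symmetric_set :: "real set \<Rightarrow> bool" where
  "symmetric_set \<Xi> \<longleftrightarrow> uminus ` \<Xi> = \<Xi>"

definition fun_space :: "real set \<Rightarrow> (real \<Rightarrow> real) set" where
  "fun_space \<Xi> =
     {f. \<exists>b :: real \<Rightarrow> complex.
           (\<forall>\<xi>\<in>\<Xi>. b (- \<xi>) = cnj (b \<xi>)) \<and>
           (\<forall>x. complex_of_real (f x) =
                  (\<Sum>\<xi>\<in>\<Xi>. b \<xi> * exp (2 * of_real pi * \<i> * of_real \<xi> * of_real x)))}"

(* The signed measure "sum of u_a delta_a" of finite support is represented by its
   finitely supported weight function u.  The support of the measure is then "keys",
   the set of points of non-zero weight. *)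
type_synonym shift_rule = "real \<Rightarrow>\<^sub>0 real"

definition shift_apply :: "shift_rule \<Rightarrow> (real \<Rightarrow> real) \<Rightarrow> real \<Rightarrow> real" where
  "shift_apply \<phi> f x = (\<Sum>a\<in>Poly_Mapping.keys \<phi>. Poly_Mapping.lookup \<phi> a * f (x - a))"

definition cost :: "shift_rule \<Rightarrow> real" where
  "cost \<phi> = (\<Sum>a\<in>Poly_Mapping.keys \<phi>. \<bar>Poly_Mapping.lookup \<phi> a\<bar>)"

(* For finite \<Xi> all elements of fun_space \<Xi> are smooth, so the iterated "deriv"
   is the genuine derivative of order \<alpha>. *)
definition feasible :: "real set \<Rightarrow> nat \<Rightarrow> shift_rule \<Rightarrow> bool" where
  "feasible \<Xi> \<alpha> \<phi> \<longleftrightarrow> (\<forall>g\<in>fun_space \<Xi>. shift_apply \<phi> g = (deriv ^^ \<alpha>) g)"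

definition optimal :: "real set \<Rightarrow> nat \<Rightarrow> shift_rule \<Rightarrow> bool" where
  "optimal \<Xi> \<alpha> \<phi> \<longleftrightarrow> feasible \<Xi> \<alpha> \<phi> \<and> cost \<phi> = (INF \<psi>\<in>{\<psi>. feasible \<Xi> \<alpha> \<psi>}. cost \<psi>)"

end

(* Let K be the largest frequency.  A feasible rule reproduces the derivative of the character of
   frequency K, so by Bernstein's argument its cost is at least (2 pi K)^\<alpha>.  Conversely, a
   feasible rule attains this bound once it is supported on the nodes a = (k - \<alpha>/2) / (2 K),
   k an integer, with weights of sign (-1)^k.  For \<alpha> = 1, M. Riesz' interpolation formula
   (the Fourier series of the triangle wave) gives such weights, but infinitely many of them.  As
   all of them are nonzero and only finitely many linear equations have to hold, the tail of the
   series can be moved onto finitely many nodes without changing signs.  The \<alpha>-fold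
   convolution of the resulting rule serves for general \<alpha>.  Finally, Caratheodory's theorem
   for cones reduces the support: on these nodes the characters of frequency K and -K give a
   single real equation, which leaves |\<Xi>| - 1 equations. *)

theory Submission
  imports Defs "HOL-Analysis.Analysis" "HOL-Real_Asymp.Real_Asymp"
begin

subsection \<open>The Fourier series of the triangle wave\<close>

text \<open>\<open>Arctan z\<close> is \<i> / 2 times the logarithm of the quotient
  \<open>w\<close>, so its real part is minus half the argument of \<open>w\<close>. Since
  \<open>w\<close> lies in the right half plane, that argument is an arctan. The formula gives the
  derivative of the damped triangle wave in closed form.\<close>

lemma Re_Arctan_cis:
  fixes r t :: real
  assumes "0 \<le> r" "r < 1"
  shows "Re (Arctan (of_real r * cis t)) = arctan (2 * r * cos t / (1 - r\<^sup>2)) / 2"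
proof -
  define z where "z = complex_of_real r * cis t"
  define w where "w = (1 - \<i> * z) / (1 + \<i> * z)"
  \<comment> \<open>The squared modulus of the denominator \<open>1 + \<i> * z\<close> of
    \<open>w\<close>.\<close>
  define m where "m = (1 - r * sin t)\<^sup>2 + (r * cos t)\<^sup>2"
  have r2: "r\<^sup>2 < 1"
    using assms by (simp add: power_less_one_iff)
  have "norm (\<i> * z) < 1"
    using assms by (simp add: z_def norm_mult)
  then have nz: "1 + \<i> * z \<noteq> 0"
    by (metis add_eq_0_iff norm_minus_cancel norm_one order_less_irrefl)
  have m: "m > 0"
  proof -
    have "r * sin t < 1"
      using assms by (smt (verit) mult_left_le sin_le_one)
    then show ?thesis
      unfolding m_def by (intro add_pos_nonneg) auto
  qed
  have re_eq: "(1 + r * sin t) * (1 - r * sin t) - (r * cos t)\<^sup>2 = 1 - r\<^sup>2"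
  proof -
    have "(1 + r * sin t) * (1 - r * sin t) - (r * cos t)\<^sup>2 = 1 - r\<^sup>2 * ((sin t)\<^sup>2 + (cos t)\<^sup>2)"
      unfolding power2_eq_square by algebra
    then show ?thesis by simp
  qed
  have Re_w: "Re w = (1 - r\<^sup>2) / m"
    unfolding re_eq[symmetric] w_def z_def m_def by (simp add: Re_divide power2_eq_square)
  have Im_w: "Im w = - (2 * r * cos t) / m"
    unfolding w_def z_def m_def by (simp add: Im_divide algebra_simps)
  have "Re w > 0"
    using r2 m by (simp add: Re_w)
  then have "w \<noteq> 0" and arg: "Arg w = arctan (Im w / Re w)"
    by (auto simp: Arg_eq_Im_Ln arg_conv_arctan)
  have "Im w / Re w = - (2 * r * cos t / (1 - r\<^sup>2))"
    using m r2 by (simp add: Re_w Im_w)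
  then have "Arg w = - arctan (2 * r * cos t / (1 - r\<^sup>2))"
    using arg by (simp only: arctan_minus)
  moreover have "Re (Arctan z) = - Im (Ln w) / 2"
    by (simp add: Arctan_def w_def)
  ultimately show ?thesis
    using \<open>w \<noteq> 0\<close> by (simp add: z_def Arg_eq_Im_Ln)
qed

lemma summable_odd_squares: "summable (\<lambda>j. 1 / (2 * real j + 1)\<^sup>2)"
proof (rule summable_comparison_test')
  show "summable (\<lambda>j. 1 / (real (Suc j))\<^sup>2)"
    using inverse_squares_sums by (simp add: sums_iff add.commute)
  show "norm (1 / (2 * real j + 1)\<^sup>2) \<le> 1 / (real (Suc j))\<^sup>2" if "j \<ge> 0" for j
    by (auto intro!: divide_left_mono power_mono mult_pos_pos)
qed

text \<open>The powers of \<open>r\<close> are Abel damping: for \<open>r < 1\<close> the series can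
  be differentiated termwise, and \<open>r = 1\<close> is the triangle wave itself.\<close>

definition tri_term :: "real \<Rightarrow> real \<Rightarrow> nat \<Rightarrow> real" where
  "tri_term r x j = (-1) ^ j * r ^ (2 * j + 1) * sin ((2 * real j + 1) * x) / (2 * real j + 1)\<^sup>2"

lemma tri_term_le:
  assumes "0 \<le> r" "r \<le> 1"
  shows "norm (tri_term r x j) \<le> 1 / (2 * real j + 1)\<^sup>2"
proof -
  have "\<bar>r ^ (2 * j + 1) * sin ((2 * real j + 1) * x)\<bar> \<le> 1 * 1"
    unfolding abs_mult using assms by (intro mult_mono) (auto simp: power_le_one simp del: power_Suc)
  then show ?thesis
    by (auto simp: tri_term_def abs_mult power_abs simp del: power_Suc intro!: divide_right_mono)
qed

text \<open>The Weierstrass test applies with a bound that depends on neither \<open>r\<close> nor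
  \<open>x\<close>. Joint continuity serves twice: in \<open>r\<close> for the Abel limit at 1, and
  in \<open>x\<close> at \<open>r = 1\<close> for the end points of the interval.\<close>

lemma continuous_on_tri:
  "continuous_on ({0..1} \<times> UNIV) (\<lambda>(r, x). suminf (tri_term r x))"
proof -
  have "uniform_limit ({0..1} \<times> UNIV) (\<lambda>n q. \<Sum>j<n. tri_term (fst q) (snd q) j)
      (\<lambda>q. suminf (tri_term (fst q) (snd q))) sequentially"
    by (rule Weierstrass_m_test[OF _ summable_odd_squares]) (use tri_term_le in auto)
  moreover have "continuous_on ({0..1} \<times> UNIV) (\<lambda>q. \<Sum>j<n. tri_term (fst q) (snd q) j)" for n
    unfolding tri_term_def by (intro continuous_intros) auto
  ultimately have "continuous_on ({0..1} \<times> UNIV) (\<lambda>q. suminf (tri_term (fst q) (snd q)))"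
    by (intro uniform_limit_theorem[where F = sequentially]) auto
  then show ?thesis
    by (simp add: case_prod_unfold)
qed

text \<open>The differentiated terms are dominated by \<open>r ^ j\<close>, uniformly in
  \<open>x\<close>, and their sum is the real part of the power series of Arctan at
  \<open>of_real r * cis x\<close>.\<close>

lemma has_field_derivative_tri:
  assumes r: "0 \<le> r" "r < 1"
  shows "((\<lambda>x. suminf (tri_term r x)) has_field_derivative
           arctan (2 * r * cos x / (1 - r\<^sup>2)) / 2) (at x)"
proof -
  define d where "d j x = (-1) ^ j * r ^ (2 * j + 1) * cos ((2 * real j + 1) * x) / (2 * real j + 1)"
    for j x
  have "((\<lambda>x. suminf (tri_term r x)) has_field_derivative suminf (\<lambda>j. d j x)) (at x)"
  proof (rule has_field_derivative_series'(2))
    show "((\<lambda>x. tri_term r x j) has_field_derivative d j x) (at x within UNIV)" for j x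
    proof -
      have "((\<lambda>x. a * sin (c * x) / c\<^sup>2) has_field_derivative a * cos (c * x) / c) (at x)"
        if "c \<noteq> 0" for a c :: real
        using that by (auto intro!: derivative_eq_intros simp: power2_eq_square)
      from this[of "2 * real j + 1" "(-1) ^ j * r ^ (2 * j + 1)"] show ?thesis
        by (simp add: tri_term_def d_def)
    qed
    show "uniformly_convergent_on UNIV (\<lambda>n x. \<Sum>j<n. d j x)"
    proof (rule Weierstrass_m_test')
      show "norm (d j x) \<le> r ^ j" for j x
      proof -
        have "\<bar>r ^ (2 * j + 1) * cos ((2 * real j + 1) * x)\<bar> \<le> r ^ j * 1"
          unfolding abs_mult power_abs using r
          by (intro mult_mono) (auto intro!: power_decreasing simp del: power_Suc)
        moreover have "norm (d j x) \<le> \<bar>r ^ (2 * j + 1) * cos ((2 * real j + 1) * x)\<bar> / 1"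
          unfolding d_def by (simp add: abs_mult power_abs del: power_Suc div_by_1, rule divide_left_mono) (auto simp del: power_Suc)
        ultimately show ?thesis by simp
      qed
      show "summable ((^) r)"
        using r by (simp add: summable_geometric)
    qed
    show "summable (\<lambda>j. tri_term r 0 j)"
      by (simp add: tri_term_def)
  qed auto
  moreover have "(\<lambda>j. d j x) sums Re (Arctan (of_real r * cis x))"
  proof -
    have "norm (of_real r * cis x) < 1"
      using r by (simp add: norm_mult)
    from sums_Re[OF Arctan_series(2)[OF this]]
    have "(\<lambda>j. Re ((-1) ^ j / of_nat (2 * j + 1) * (of_real r * cis x) ^ (2 * j + 1))) sums
        Re (Arctan (of_real r * cis x))" .
    moreover have "Re ((-1) ^ j / of_nat (2 * j + 1) * (of_real r * cis x) ^ (2 * j + 1)) = d j x" for j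
    proof -
      have "(of_real r * cis x) ^ (2 * j + 1) =
          of_real (r ^ (2 * j + 1)) * cis ((2 * real j + 1) * x)"
        using Complex.DeMoivre[of x "2 * j + 1"]
        by (simp only: power_mult_distrib of_real_power) (simp add: add.commute)
      moreover have "(-1) ^ j / of_nat (2 * j + 1) = complex_of_real ((-1) ^ j / (2 * real j + 1))"
        by simp
      ultimately have "(-1) ^ j / of_nat (2 * j + 1) * (of_real r * cis x) ^ (2 * j + 1) =
          complex_of_real ((-1) ^ j / (2 * real j + 1) * r ^ (2 * j + 1)) * cis ((2 * real j + 1) * x)"
        by (simp only: of_real_mult mult.assoc)
      then show ?thesis
        by (simp only: times_complex.sel Re_complex_of_real Im_complex_of_real cis.sel d_def) simp
    qed
    ultimately show ?thesis by simp
  qed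
  then have "suminf (\<lambda>j. d j x) = arctan (2 * r * cos x / (1 - r\<^sup>2)) / 2"
    unfolding Re_Arctan_cis[OF r] by (rule sums_unique[symmetric])
  ultimately show ?thesis by simp
qed

text \<open>By the mean value theorem the damped sum is \<open>x * h r t\<close> for some
  \<open>t\<close> between 0 and \<open>x\<close>. As cosine decreases there, \<open>h r x\<close>
  \<le> \<open>h r t\<close> \<le> pi / 4. Because cos x > 0, the lower bound also tends to pi / 4
  as \<open>r\<close> tends to 1.\<close>

lemma tri_limit:
  assumes x: "0 < x" "x < pi / 2"
  shows "suminf (tri_term 1 x) = pi / 4 * x"
proof -
  define h where "h r t = arctan (2 * r * cos t / (1 - r\<^sup>2)) / 2" for r t :: real
  have "continuous_on {0..1} (\<lambda>r. suminf (tri_term r x))"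
    using continuous_on_compose2[OF continuous_on_tri, of "{0..1}" "\<lambda>r. (r, x)"]
    by (simp add: continuous_on_Pair image_subset_iff)
  then have "((\<lambda>r. suminf (tri_term r x)) \<longlongrightarrow> suminf (tri_term 1 x)) (at 1 within {0..1})"
    by (simp add: continuous_on_def)
  then have lim1: "((\<lambda>r. suminf (tri_term r x)) \<longlongrightarrow> suminf (tri_term 1 x)) (at_left 1)"
    by (simp add: at_within_Icc_at_left)
  have bounds: "x * h r x \<le> suminf (tri_term r x) \<and> suminf (tri_term r x) \<le> pi / 4 * x" if r: "0 < r" "r < 1" for r
  proof -
    obtain t where t: "0 < t" "t < x"
      "suminf (tri_term r x) - suminf (tri_term r 0) = (x - 0) * h r t"
      using MVT2[OF x(1) has_field_derivative_tri, of r] r unfolding h_def by auto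
    have r2: "r\<^sup>2 < 1"
      using r by (simp add: power_less_one_iff)
    have "cos x \<le> cos t"
      using t x by (intro cos_monotone_0_pi_le) auto
    then have "h r x \<le> h r t"
      using r r2 by (auto simp: h_def arctan_le_iff intro!: divide_right_mono mult_left_mono)
    moreover have "h r t \<le> pi / 4"
      using arctan_ubound[of "2 * r * cos t / (1 - r\<^sup>2)"] by (simp add: h_def)
    moreover have "suminf (tri_term r 0) = 0"
      by (simp add: tri_term_def[abs_def])
    ultimately show ?thesis
      using t x by (auto intro: mult_left_mono)
  qed
  have "cos x > 0"
    using x by (intro cos_gt_zero) auto
  have "filterlim (\<lambda>r. 2 * r * cos x / (1 - r\<^sup>2)) at_top (at_left 1)"
    using \<open>cos x > 0\<close> by real_asymp
  then have lower: "((\<lambda>r. x * h r x) \<longlongrightarrow> x * (pi / 2 / 2)) (at_left 1)"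
    unfolding h_def by (intro tendsto_intros filterlim_compose[OF tendsto_arctan_at_top]) auto
  have "\<forall>\<^sub>F r in at_left (1::real). 0 < r \<and> r < 1"
    using eventually_at_left_real[of 0 "1::real"] by (auto elim: eventually_mono)
  then have ev: "\<forall>\<^sub>F r in at_left 1. x * h r x \<le> suminf (tri_term r x)"
    "\<forall>\<^sub>F r in at_left 1. suminf (tri_term r x) \<le> x * (pi / 2 / 2)"
    by (rule eventually_mono, use bounds in \<open>simp add: mult.commute\<close>)+
  have "((\<lambda>r. suminf (tri_term r x)) \<longlongrightarrow> x * (pi / 2 / 2)) (at_left 1)"
    by (rule tendsto_sandwich[OF ev lower tendsto_const])
  from tendsto_unique[OF trivial_limit_at_left_real lim1 this] show ?thesis
    by simp
qed

text \<open>The end points 0 and pi / 2 follow from the open interval by continuity, and negative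
  arguments follow because every term is odd.\<close>

lemma triangle_wave_sums:
  assumes x: "\<bar>x\<bar> \<le> pi / 2"
  shows "(\<lambda>j. (-1) ^ j * sin ((2 * real j + 1) * x) / (2 * real j + 1)\<^sup>2) sums (pi / 4 * x)"
proof -
  have "continuous_on {0..pi/2} (\<lambda>x. suminf (tri_term 1 x))"
    using continuous_on_compose2[OF continuous_on_tri, of "{0..pi/2}" "\<lambda>x. (1, x)"]
    by (simp add: continuous_on_Pair image_subset_iff)
  then have cont: "continuous_on {0..pi/2} (\<lambda>x. suminf (tri_term 1 x) - pi / 4 * x)"
    by (intro continuous_intros)
  have nonneg: "suminf (tri_term 1 y) = pi / 4 * y" if "y \<in> {0..pi/2}" for y
  proof -
    have "suminf (tri_term 1 y) - pi / 4 * y = 0"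
      using continuous_constant_on_closure[of "{0<..<pi/2}" "\<lambda>x. suminf (tri_term 1 x) - pi / 4 * x" 0 y]
        cont that tri_limit by simp
    then show ?thesis by simp
  qed
  have odd: "tri_term 1 (- y) = (\<lambda>j. - tri_term 1 y j)" for y
    by (simp add: tri_term_def fun_eq_iff)
  have sm: "summable (tri_term 1 y)" for y
    by (rule summable_comparison_test'[OF summable_odd_squares]) (use tri_term_le[of 1 y] in auto)
  have "suminf (tri_term 1 x) = pi / 4 * x"
  proof (cases "x \<ge> 0")
    case True
    then show ?thesis using nonneg[of x] x by auto
  next
    case False
    then have "suminf (tri_term 1 (- x)) = pi / 4 * (- x)"
      using x by (intro nonneg) auto
    moreover have "suminf (tri_term 1 (- x)) = - suminf (tri_term 1 x)"
      using suminf_minus[OF sm, of x] by (simp add: odd)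
    ultimately show ?thesis by simp
  qed
  then have "tri_term 1 x sums (pi / 4 * x)"
    using summable_sums[OF sm] by metis
  then show ?thesis
    by (simp add: tri_term_def[abs_def])
qed

subsection \<open>Positive combinations in finite dimension\<close>

text \<open>The vectors \<open>p k\<close> live in a finite-dimensional space; the point is that the
  coefficients stay bounded uniformly in \<open>k\<close>. The induction eliminates coordinate
  \<open>i\<close> with a pivot vector \<open>p k0\<close>, and the multiples \<open>d k\<close>
  that are subtracted are bounded because coordinate \<open>i\<close> is.\<close>

lemma finite_bounded_spanning:
  fixes p :: "'k \<Rightarrow> 'i \<Rightarrow> real"
  assumes "finite I" "\<forall>i\<in>I. \<exists>B. \<forall>k. \<bar>p k i\<bar> \<le> B"
  shows "\<exists>F c B. finite F \<and> (\<forall>k. \<forall>i\<in>I. p k i = (\<Sum>j\<in>F. c k j * p j i)) \<and>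
           (\<forall>k. \<forall>j\<in>F. \<bar>c k j\<bar> \<le> B)"
  using assms
proof (induction I arbitrary: p rule: finite_induct)
  case empty
  show ?case
    by (intro exI[of _ "{}"]) auto
next
  case (insert i I)
  show ?case
  proof (cases "\<forall>k. p k i = 0")
    case True
    from insert.IH[of p] insert.prems obtain F c B where
      "finite F" "\<forall>k. \<forall>i\<in>I. p k i = (\<Sum>j\<in>F. c k j * p j i)" "\<forall>k. \<forall>j\<in>F. \<bar>c k j\<bar> \<le> (B::real)"
      by auto
    then show ?thesis
      using True by (intro exI[of _ F] exI[of _ c] exI[of _ B]) auto
  next
    case False
    then obtain k0 where k0: "p k0 i \<noteq> 0" by auto
    define d where "d k = p k i / p k0 i" for k
    define q where "q k l = p k l - d k * p k0 l" for k l
    from insert.prems obtain D0 where D0: "\<And>k. \<bar>p k i\<bar> \<le> D0" by auto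
    have "D0 \<ge> 0"
      using D0[of k0] by linarith
    have d: "\<bar>d k\<bar> \<le> D0 / \<bar>p k0 i\<bar>" for k
      using D0 by (simp add: d_def divide_right_mono)
    have "\<forall>l\<in>I. \<exists>B. \<forall>k. \<bar>q k l\<bar> \<le> B"
    proof
      fix l assume "l \<in> I"
      with insert.prems obtain B where B: "\<And>k. \<bar>p k l\<bar> \<le> B"
        by (meson insertI2)
      have "\<bar>q k l\<bar> \<le> B + D0 / \<bar>p k0 i\<bar> * B" for k
      proof -
        have "\<bar>q k l\<bar> \<le> \<bar>p k l\<bar> + \<bar>d k\<bar> * \<bar>p k0 l\<bar>"
          unfolding q_def using abs_triangle_ineq4[of "p k l" "d k * p k0 l"] by (simp add: abs_mult)
        also have "\<dots> \<le> B + D0 / \<bar>p k0 i\<bar> * B"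
          using d B \<open>D0 \<ge> 0\<close> by (intro add_mono mult_mono) auto
        finally show ?thesis .
      qed
      then show "\<exists>B. \<forall>k. \<bar>q k l\<bar> \<le> B" by blast
    qed
    from insert.IH[OF this] obtain F c B where F: "finite F"
      and c_all: "\<forall>k. \<forall>l\<in>I. q k l = (\<Sum>j\<in>F. c k j * q j l)"
      and B_all: "\<forall>k. \<forall>j\<in>F. \<bar>c k j\<bar> \<le> (B::real)"
      by blast
    have c: "q k l = (\<Sum>j\<in>F. c k j * q j l)" if "l \<in> I" for k l
      using c_all that by blast
    have B: "\<bar>c k j\<bar> \<le> B" if "j \<in> F" for k j
      using B_all that by blast
    \<comment> \<open>As \<open>q k0\<close> vanishes, \<open>k0\<close> can leave the spanning set
      of the reduced vectors. Its coefficient is then free to compensate for all multiples of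
      \<open>p k0\<close> that were subtracted.\<close>
    define G where "G = F - {k0}"
    have G: "finite G" "k0 \<notin> G"
      using F by (auto simp: G_def)
    define c' where "c' k j = (if j = k0 then d k - (\<Sum>j\<in>G. c k j * d j) else c k j)" for k j
    have q_k0: "q k0 l = 0" for l
      using k0 by (simp add: q_def d_def)
    have q_i: "q k i = 0" for k
      using k0 by (simp add: q_def d_def)
    have q: "q k l = (\<Sum>j\<in>G. c k j * q j l)" if "l \<in> insert i I" for k l
    proof (cases "l = i")
      case False
      then have "q k l = (\<Sum>j\<in>F. c k j * q j l)"
        using c that by auto
      also have "\<dots> = (\<Sum>j\<in>G. c k j * q j l)"
        unfolding G_def using F q_k0 by (intro sum.mono_neutral_right) auto
      finally show ?thesis .
    qed (simp add: q_i)
    have "p k l = (\<Sum>j\<in>insert k0 G. c' k j * p j l)" if "l \<in> insert i I" for k l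
    proof -
      have "(\<Sum>j\<in>insert k0 G. c' k j * p j l) = c' k k0 * p k0 l + (\<Sum>j\<in>G. c' k j * p j l)"
        using G by (rule sum.insert)
      also have "(\<Sum>j\<in>G. c' k j * p j l) = (\<Sum>j\<in>G. c k j * p j l)"
        by (intro sum.cong) (auto simp: c'_def G_def)
      also have "\<dots> = (\<Sum>j\<in>G. c k j * q j l) + (\<Sum>j\<in>G. c k j * d j) * p k0 l"
        by (simp add: q_def algebra_simps sum.distrib sum_distrib_left sum_subtractf)
      also have "(\<Sum>j\<in>G. c k j * q j l) = q k l"
        using q[OF that, of k] by (rule sym)
      finally show ?thesis
        by (simp add: c'_def q_def algebra_simps)
    qed
    moreover have "\<bar>c' k j\<bar> \<le> max \<bar>B\<bar> (D0 / \<bar>p k0 i\<bar> + (\<Sum>j\<in>G. \<bar>B\<bar> * (D0 / \<bar>p k0 i\<bar>)))"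
      if "j \<in> insert k0 G" for k j
    proof (cases "j = k0")
      case False
      then show ?thesis
        using B[of j k] that by (auto simp: c'_def G_def)
    next
      case True
      have "\<bar>\<Sum>j\<in>G. c k j * d j\<bar> \<le> (\<Sum>j\<in>G. \<bar>c k j * d j\<bar>)"
        by (rule sum_abs)
      also have "\<dots> \<le> (\<Sum>j\<in>G. \<bar>B\<bar> * (D0 / \<bar>p k0 i\<bar>))"
      proof (rule sum_mono)
        fix j assume "j \<in> G"
        then have "\<bar>c k j\<bar> \<le> \<bar>B\<bar>"
          using B[of j k] by (auto simp: G_def)
        then show "\<bar>c k j * d j\<bar> \<le> \<bar>B\<bar> * (D0 / \<bar>p k0 i\<bar>)"
          unfolding abs_mult using d[of j] by (intro mult_mono) auto
      qed
      finally have "\<bar>\<Sum>j\<in>G. c k j * d j\<bar> \<le> (\<Sum>j\<in>G. \<bar>B\<bar> * (D0 / \<bar>p k0 i\<bar>))" .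
      moreover have "\<bar>c' k j\<bar> \<le> \<bar>d k\<bar> + \<bar>\<Sum>j\<in>G. c k j * d j\<bar>"
        using True by (simp add: c'_def)
      ultimately show ?thesis
        using d[of k] by (intro max.coboundedI2) linarith
    qed
    moreover have "finite (insert k0 G)"
      using G by simp
    ultimately show ?thesis
      by (intro exI[of _ "insert k0 G"] exI[of _ c']) blast
  qed
qed

text \<open>The tail of the series is a small combination of finitely many spanning terms, so it can be
  absorbed by the strictly positive weights of these terms.\<close>

lemma positive_series_finite:
  fixes p :: "nat \<Rightarrow> 'i \<Rightarrow> real"
  assumes I: "finite I" "\<forall>i\<in>I. \<exists>B. \<forall>k. \<bar>p k i\<bar> \<le> B"
    and w: "\<And>k. w k > 0" "summable w"
    and T: "\<And>i. i \<in> I \<Longrightarrow> (\<lambda>k. w k * p k i) sums T i"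
  shows "\<exists>N v. (\<forall>k<N. v k \<ge> 0) \<and> (\<forall>i\<in>I. (\<Sum>k<N. v k * p k i) = T i)"
proof -
  obtain F c B where F: "finite F"
    and c: "\<And>k i. i \<in> I \<Longrightarrow> p k i = (\<Sum>j\<in>F. c k j * p j i)"
    and B: "\<And>k j. j \<in> F \<Longrightarrow> \<bar>c k j\<bar> \<le> (B::real)"
    using finite_bounded_spanning[OF I] by metis
  \<comment> \<open>The least weight available for absorbing the tail; the 1 keeps the minimum
    meaningful when \<open>F\<close> is empty.\<close>
  define m where "m = Min (insert 1 (w ` F))"
  have m: "m > 0" "\<And>j. j \<in> F \<Longrightarrow> m \<le> w j"
    using F w by (auto simp: m_def)
  have "(\<lambda>n. \<bar>B\<bar> * suminf (\<lambda>k. w (k + n))) \<longlonglongrightarrow> \<bar>B\<bar> * 0"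
    by (intro tendsto_intros suminf_exist_split2 w)
  then have "\<forall>\<^sub>F n in sequentially. \<bar>B\<bar> * suminf (\<lambda>k. w (k + n)) < m"
    using m(1) by (auto dest: order_tendstoD(2))
  moreover have "\<forall>\<^sub>F n in sequentially. F \<subseteq> {..<n}"
    using F by (metis (mono_tags, lifting) eventually_at_top_linorderI finite_nat_iff_bounded
        lessThan_subset_iff subset_trans)
  ultimately obtain N where N: "\<bar>B\<bar> * suminf (\<lambda>k. w (k + N)) < m" "F \<subseteq> {..<N}"
    by (metis (mono_tags, lifting) eventually_conj eventually_happens' sequentially_bot)
  \<comment> \<open>The total weight that lands on the spanning index \<open>j\<close> when every
    term from \<open>N\<close> on is rewritten in spanning terms. By the choice of \<open>N\<close>
    it is smaller in absolute value than \<open>w j\<close>.\<close>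
  define e where "e j = suminf (\<lambda>k. w (k + N) * c (k + N) j)" for j
  have tail: "summable (\<lambda>k. w (k + N))"
    using w by (simp add: summable_iff_shift)
  have bd: "norm (w (k + N) * c (k + N) j) \<le> w (k + N) * \<bar>B\<bar>" if "j \<in> F" for j k
    using B[OF that, of "k + N"] w(1)[of "k + N"] by (auto simp: abs_mult)
  have sm: "summable (\<lambda>k. w (k + N) * c (k + N) j)" if "j \<in> F" for j
    by (rule summable_comparison_test'[OF summable_mult2[OF tail] bd[OF that]])
  have e: "\<bar>e j\<bar> < w j" if "j \<in> F" for j
  proof -
    have "norm (e j) \<le> suminf (\<lambda>k. w (k + N) * \<bar>B\<bar>)"
      unfolding e_def by (rule norm_suminf_le[OF bd[OF that] summable_mult2[OF tail]])
    also have "\<dots> = \<bar>B\<bar> * suminf (\<lambda>k. w (k + N))"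
      using suminf_mult2[OF tail] by (simp add: mult.commute)
    also have "\<dots> < m" by (rule N)
    also have "\<dots> \<le> w j" using m that by simp
    finally show ?thesis by simp
  qed
  define v where "v k = w k + (if k \<in> F then e k else 0)" for k
  have "v k \<ge> 0" for k
    using e[of k] w(1)[of k] by (auto simp: v_def)
  moreover have "(\<Sum>k<N. v k * p k i) = T i" if i: "i \<in> I" for i
  proof -
    have "(\<lambda>k. \<Sum>j\<in>F. w (k + N) * c (k + N) j * p j i) sums (\<Sum>j\<in>F. e j * p j i)"
      unfolding e_def by (intro sums_sum sums_mult2 summable_sums sm)
    also have "(\<lambda>k. \<Sum>j\<in>F. w (k + N) * c (k + N) j * p j i) = (\<lambda>k. w (k + N) * p (k + N) i)"
      by (subst c[OF i, of "_ + N"]) (simp add: sum_distrib_left mult.assoc)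
    finally have "(\<lambda>k. w k * p k i) sums ((\<Sum>j\<in>F. e j * p j i) + (\<Sum>k<N. w k * p k i))"
      by (rule sums_iff_shift[THEN iffD1])
    then have "T i = (\<Sum>j\<in>F. e j * p j i) + (\<Sum>k<N. w k * p k i)"
      using T[OF i] sums_unique2 by blast
    also have "(\<Sum>j\<in>F. e j * p j i) = (\<Sum>k<N. (if k \<in> F then e k else 0) * p k i)"
      using N(2) by (intro sum.mono_neutral_cong_left) auto
    finally show ?thesis
      by (simp add: v_def algebra_simps sum.distrib)
  qed
  ultimately show ?thesis by blast
qed

section \<open>Caratheodory's theorem for cones\<close>

lemma underdetermined_system:
  fixes p :: "'k \<Rightarrow> 'i \<Rightarrow> real"
  assumes "finite I" "finite F" "card I < card F"
  shows "\<exists>z. (\<exists>k\<in>F. z k \<noteq> 0) \<and> (\<forall>i\<in>I. (\<Sum>k\<in>F. z k * p k i) = 0)"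
  using assms
proof (induction I arbitrary: F p rule: finite_induct)
  case empty
  then show ?case
    by (intro exI[of _ "\<lambda>_. 1"]) (auto simp: card_gt_0_iff)
next
  case (insert i I)
  show ?case
  proof (cases "\<forall>k\<in>F. p k i = 0")
    case True
    have "card I < card F" using insert by simp
    from insert.IH[OF insert.prems(1) this, of p] obtain z where
      z: "\<exists>k\<in>F. z k \<noteq> 0" "\<forall>l\<in>I. (\<Sum>k\<in>F. z k * p k l) = 0" by blast
    moreover have "(\<Sum>k\<in>F. z k * p k i) = 0"
      using True by (simp add: sum.neutral)
    ultimately show ?thesis
      by (intro exI[of _ z] conjI ballI) auto
  next
    case False
    then obtain k0 where k0: "k0 \<in> F" "p k0 i \<noteq> 0" by auto
    define G where "G = F - {k0}"
    have G: "finite G" "k0 \<notin> G" "F = insert k0 G"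
      using k0 insert.prems by (auto simp: G_def)
    then have "card I < card G"
      using insert by simp
    \<comment> \<open>Gaussian elimination of coordinate \<open>i\<close> with the pivot
      \<open>k0\<close>.\<close>
    define q where "q k l = p k l - p k i / p k0 i * p k0 l" for k l
    from insert.IH[OF G(1) \<open>card I < card G\<close>, of q] obtain z where
      z: "\<exists>k\<in>G. z k \<noteq> 0" "\<And>l. l \<in> I \<Longrightarrow> (\<Sum>k\<in>G. z k * q k l) = 0" by blast
    have z': "(\<Sum>k\<in>G. z k * q k l) = 0" if "l \<in> insert i I" for l
      using that z(2) k0 by (auto simp: q_def)
    \<comment> \<open>The value that equation \<open>i\<close> forces on the pivot unknown.\<close>
    define z0 where "z0 = - (\<Sum>k\<in>G. z k * (p k i / p k0 i))"
    have "(\<Sum>k\<in>F. (z(k0 := z0)) k * p k l) = 0" if "l \<in> insert i I" for l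
    proof -
      have "(\<Sum>k\<in>F. (z(k0 := z0)) k * p k l) = z0 * p k0 l + (\<Sum>k\<in>G. z k * p k l)"
        unfolding G(3) using G by (auto intro!: sum.cong)
      also have "\<dots> = (\<Sum>k\<in>G. z k * q k l)"
        by (simp add: z0_def q_def algebra_simps sum_subtractf sum_distrib_left sum_distrib_right)
      finally show ?thesis using z'[OF that] by simp
    qed
    moreover have "\<exists>k\<in>F. (z(k0 := z0)) k \<noteq> 0"
      using z(1) G by auto
    ultimately show ?thesis by blast
  qed
qed

text \<open>While there are more points than equations, a linear relation \<open>z\<close> exists.
  Moving the weights along it preserves all sums, and stopping when the first weight reaches 0
  removes a point.\<close>

lemma conic_caratheodory:
  fixes p :: "'k \<Rightarrow> 'i \<Rightarrow> real"
  assumes I: "finite I" and "finite F" "\<forall>k\<in>F. w k \<ge> 0"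
  shows "\<exists>G v. G \<subseteq> F \<and> card G \<le> card I \<and> (\<forall>k\<in>G. v k \<ge> 0) \<and>
           (\<forall>i\<in>I. (\<Sum>k\<in>G. v k * p k i) = (\<Sum>k\<in>F. w k * p k i))"
  using assms(2,3)
proof (induction "card F" arbitrary: F w rule: less_induct)
  case less
  show ?case
  proof (cases "card F \<le> card I")
    case True
    then show ?thesis using less.prems by blast
  next
    case False
    with underdetermined_system[OF I less.prems(1), of p] obtain z0 where
      z0: "\<exists>k\<in>F. z0 k \<noteq> 0" "\<And>i. i \<in> I \<Longrightarrow> (\<Sum>k\<in>F. z0 k * p k i) = 0" by auto
    \<comment> \<open>After a change of sign if necessary, some coefficient is positive, so that
      some weight really decreases along the way.\<close>
    obtain z where z: "\<exists>k\<in>F. z k > 0" "\<And>i. i \<in> I \<Longrightarrow> (\<Sum>k\<in>F. z k * p k i) = 0"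
    proof (cases "\<exists>k\<in>F. z0 k > 0")
      case True
      then show ?thesis using z0 that by blast
    next
      case False
      with z0(1) have "\<exists>k\<in>F. - z0 k > 0"
        by (metis linorder_neqE_linordered_idom neg_0_less_iff_less)
      then show ?thesis
        using z0(2) that[of "\<lambda>k. - z0 k"] by (simp add: sum_negf)
    qed
    define P where "P = {k \<in> F. z k > 0}"
    have P: "finite P" "P \<noteq> {}"
      using less.prems z(1) by (auto simp: P_def)
    \<comment> \<open>The ratio test: \<open>t\<close> is the largest step that keeps all weights
      nonnegative, and \<open>k1\<close> is an index whose weight then vanishes.\<close>
    define k1 where "k1 = arg_min_on (\<lambda>k. w k / z k) P"
    define t where "t = w k1 / z k1"
    have k1: "k1 \<in> P"
      unfolding k1_def by (rule arg_min_if_finite[OF P])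
    have t_le: "t \<le> w k / z k" if "k \<in> P" for k
      unfolding t_def k1_def by (rule arg_min_least[OF P that])
    have "t \<ge> 0"
      using k1 less.prems by (auto simp: t_def P_def)
    define u where "u k = w k - t * z k" for k
    have u: "u k \<ge> 0" if "k \<in> F" for k
    proof (cases "z k > 0")
      case True
      then show ?thesis
        using t_le[of k] that by (auto simp: P_def u_def field_simps)
    next
      case False
      then have "t * z k \<le> 0"
        using \<open>t \<ge> 0\<close> by (simp add: mult_nonneg_nonpos)
      then show ?thesis
        using less.prems that by (force simp: u_def)
    qed
    have "k1 \<in> F" "u k1 = 0"
      using k1 by (auto simp: P_def u_def t_def)
    have "card (F - {k1}) < card F"
      using \<open>k1 \<in> F\<close> less.prems by (intro psubset_card_mono) auto
    from less.hyps[OF this, of u] u less.prems obtain G v where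
      G: "G \<subseteq> F - {k1}" "card G \<le> card I" "\<forall>k\<in>G. v k \<ge> 0"
        "\<And>i. i \<in> I \<Longrightarrow> (\<Sum>k\<in>G. v k * p k i) = (\<Sum>k\<in>F - {k1}. u k * p k i)" by auto
    have "(\<Sum>k\<in>F - {k1}. u k * p k i) = (\<Sum>k\<in>F. w k * p k i)" if i: "i \<in> I" for i
    proof -
      have "(\<Sum>k\<in>F - {k1}. u k * p k i) = (\<Sum>k\<in>F. u k * p k i)"
        using less.prems \<open>u k1 = 0\<close> by (intro sum.mono_neutral_left) auto
      also have "\<dots> = (\<Sum>k\<in>F. w k * p k i) - t * (\<Sum>k\<in>F. z k * p k i)"
        by (simp add: u_def algebra_simps sum_subtractf sum_distrib_left)
      finally show ?thesis using z(2)[OF i] by simp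
    qed
    with G show ?thesis by (intro exI[of _ G] exI[of _ v]) auto
  qed
qed

subsection \<open>Sums of characters with alternating signs\<close>

text \<open>With \<open>\<theta> = \<pi> \<xi> / K\<close> this is the character \<open>exp (- 2 \<pi> \<i> \<xi> a)\<close> at the node
  \<open>a = (k - n / 2) / (2 K)\<close>, multiplied by the sign \<open>(-1)\<^sup>k\<close>.\<close>

definition alt_char :: "nat \<Rightarrow> int \<Rightarrow> real \<Rightarrow> complex" where
  "alt_char n k \<theta> = cis (pi * of_int k - \<theta> * (of_int k - real n / 2))"

lemma cis_pi_int: "cis (pi * of_int k) = of_real (cos (pi * of_int k))"
  by (simp add: complex_eq_iff)

text \<open>Convolution of rules adds nodes and multiplies signs; the shift by \<open>n / 2\<close>
  in the definition makes the half-integer offsets add up as well.\<close>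

lemma alt_char_mult: "alt_char m j \<theta> * alt_char n k \<theta> = alt_char (m + n) (j + k) \<theta>"
  by (simp add: alt_char_def cis_mult algebra_simps add_divide_distrib)

lemma alt_char_minus: "alt_char n k (- \<theta>) = cnj (alt_char n k \<theta>)"
proof -
  have "alt_char n k (- \<theta>) = cis (pi * of_int k) * cis (\<theta> * (of_int k - real n / 2))"
    by (simp add: alt_char_def cis_mult)
  moreover have "alt_char n k \<theta> = cis (pi * of_int k) * cis (- (\<theta> * (of_int k - real n / 2)))"
    by (simp add: alt_char_def cis_mult)
  ultimately show ?thesis
    by (simp add: cis_pi_int cis_cnj)
qed

text \<open>At the top frequency the alternating sign cancels the dependence on the node. This makes
  the cost bound sharp and later saves one equation.\<close>

lemma alt_char_pi: "alt_char n k pi = cis (pi * real n / 2)"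
  by (simp add: alt_char_def algebra_simps)

lemma Im_alt_char_0: "Im (alt_char n k 0) = 0"
  by (simp add: alt_char_def)

text \<open>Up to scaling, these are the Fourier transforms of finite rules on the nodes of order
  \<open>n\<close> with alternating signs. The inductive form gives closure under sums and products
  by rule induction, without index bookkeeping.\<close>

inductive_set alt_cone :: "nat \<Rightarrow> (real \<Rightarrow> complex) set" for n where
  zero: "(\<lambda>_. 0) \<in> alt_cone n"
| add_char: "\<lbrakk>c \<in> alt_cone n; w \<ge> 0\<rbrakk> \<Longrightarrow> (\<lambda>\<theta>. c \<theta> + of_real w * alt_char n k \<theta>) \<in> alt_cone n"

lemma alt_cone_add:
  assumes "c \<in> alt_cone n" "d \<in> alt_cone n"
  shows "(\<lambda>\<theta>. c \<theta> + d \<theta>) \<in> alt_cone n"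
  using assms(2)
proof induction
  case (add_char d w k)
  then show ?case
    using alt_cone.add_char[of "\<lambda>\<theta>. c \<theta> + d \<theta>" n w k] by (simp add: add.assoc)
qed (use assms(1) in simp)

lemma alt_cone_char_mult:
  assumes "c \<in> alt_cone n" "w \<ge> 0"
  shows "(\<lambda>\<theta>. c \<theta> * (of_real w * alt_char m k \<theta>)) \<in> alt_cone (n + m)"
  using assms(1)
proof induction
  case (add_char d v j)
  have "(\<lambda>\<theta>. (d \<theta> + of_real v * alt_char n j \<theta>) * (of_real w * alt_char m k \<theta>)) =
      (\<lambda>\<theta>. d \<theta> * (of_real w * alt_char m k \<theta>) + of_real (v * w) * alt_char (n + m) (j + k) \<theta>)"
    unfolding alt_char_mult[symmetric] by (simp add: algebra_simps)
  then show ?case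
    using alt_cone.add_char[OF add_char.IH, of "v * w" "j + k"] add_char.hyps assms(2) by simp
qed (simp add: alt_cone.zero)

lemma alt_cone_mult:
  assumes "c \<in> alt_cone m" "d \<in> alt_cone n"
  shows "(\<lambda>\<theta>. c \<theta> * d \<theta>) \<in> alt_cone (m + n)"
  using assms(2)
proof induction
  case (add_char d w k)
  then show ?case
    using alt_cone_add[OF add_char.IH alt_cone_char_mult[OF assms(1) add_char.hyps(2), of n k]]
    by (simp add: distrib_left)
qed (simp add: alt_cone.zero)

text \<open>The n-fold convolution, seen on the side of Fourier transforms.\<close>

lemma alt_cone_power:
  assumes "c \<in> alt_cone 1"
  shows "(\<lambda>\<theta>. c \<theta> ^ n) \<in> alt_cone n"
proof (induction n)
  case 0
  show ?case
    using alt_cone.add_char[OF alt_cone.zero, of 1 0 0] by (simp add: alt_char_def)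
next
  case (Suc n)
  then show ?case
    using alt_cone_mult[OF assms Suc] by simp
qed

text \<open>Letting the weights vanish outside \<open>F\<close> makes the update
  \<open>w(k := w k + v)\<close> correct whether or not \<open>k\<close> already belongs to
  \<open>F\<close>.\<close>

lemma alt_cone_finite_sum:
  assumes "c \<in> alt_cone n"
  shows "\<exists>F w. finite F \<and> (\<forall>k. w k \<ge> 0) \<and> (\<forall>k. k \<notin> F \<longrightarrow> w k = 0) \<and>
           (\<forall>\<theta>. c \<theta> = (\<Sum>k\<in>F. of_real (w k) * alt_char n k \<theta>))"
  using assms
proof induction
  case zero
  show ?case by (intro exI[of _ "{}"] exI[of _ "\<lambda>_. 0"]) auto
next
  case (add_char c v k)
  then obtain F w where F: "finite F" "\<forall>k. w k \<ge> 0" "\<forall>k. k \<notin> F \<longrightarrow> w k = 0"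
    and c: "\<forall>\<theta>. c \<theta> = (\<Sum>k\<in>F. of_real (w k) * alt_char n k \<theta>)"
    by blast
  have "(\<Sum>j\<in>insert k F. of_real ((w(k := w k + v)) j) * alt_char n j \<theta>) =
      c \<theta> + of_real v * alt_char n k \<theta>" for \<theta>
  proof -
    have "(\<Sum>j\<in>insert k F. of_real ((w(k := w k + v)) j) * alt_char n j \<theta>) =
        (\<Sum>j\<in>insert k F. of_real (w j) * alt_char n j \<theta> +
          (if j = k then of_real v * alt_char n k \<theta> else 0))"
      by (intro sum.cong) (auto simp: algebra_simps)
    also have "\<dots> = (\<Sum>j\<in>insert k F. of_real (w j) * alt_char n j \<theta>) + of_real v * alt_char n k \<theta>"
      using F(1) by (simp add: sum.distrib sum.delta)
    also have "(\<Sum>j\<in>insert k F. of_real (w j) * alt_char n j \<theta>) = c \<theta>"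
      using F c by (auto simp: sum.insert_if)
    finally show ?thesis .
  qed
  then show ?case
    using F add_char.hyps(2)
    by (intro exI[of _ "insert k F"] exI[of _ "w(k := w k + v)"]) auto
qed

text \<open>The triangle wave series is M. Riesz' interpolation formula for the first derivative.\<close>

lemma first_order_alt_cone:
  assumes "finite \<Theta>" "\<forall>\<theta>\<in>\<Theta>. \<bar>\<theta>\<bar> \<le> pi"
  shows "\<exists>c\<in>alt_cone 1. \<forall>\<theta>\<in>\<Theta>. c \<theta> = \<i> * of_real \<theta>"
proof -
  \<comment> \<open>The nodes with indices \<open>- j\<close> and \<open>j + 1\<close> lie
    symmetrically about 1 / 2, and \<open>\<i> * p j \<theta>\<close> is the sum of their two
    characters. The triangle wave at \<open>\<theta> / 2\<close>, multiplied by 8 / pi, equals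
    \<open>\<theta>\<close>; the factor 2 in \<open>p\<close> leaves 4 / pi for the weights.\<close>
  define p where "p j \<theta> = 2 * (-1) ^ j * sin (\<theta> * (real j + 1 / 2))" for j \<theta>
  define w where "w j = 4 / pi * (1 / (2 * real j + 1)\<^sup>2)" for j
  have "\<bar>p j \<theta>\<bar> \<le> 2" for j \<theta>
    by (simp add: p_def abs_mult power_abs)
  moreover have "w j > 0" for j
    by (simp add: w_def)
  moreover have "summable w"
    unfolding w_def by (intro summable_mult summable_odd_squares)
  moreover have "(\<lambda>j. w j * p j \<theta>) sums \<theta>" if "\<theta> \<in> \<Theta>" for \<theta>
  proof -
    have "\<bar>\<theta> / 2\<bar> \<le> pi / 2"
      using assms(2) that by auto
    note sums_mult[OF triangle_wave_sums[OF this], of "8 / pi"]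
    moreover have "w j * p j \<theta> =
        8 / pi * ((-1) ^ j * sin ((2 * real j + 1) * (\<theta> / 2)) / (2 * real j + 1)\<^sup>2)" for j
    proof -
      have half: "(2 * real j + 1) * (\<theta> / 2) = \<theta> * (real j + 1 / 2)"
        by (simp add: algebra_simps)
      show ?thesis
        unfolding half w_def p_def by simp
    qed
    ultimately show ?thesis by simp
  qed
  ultimately obtain N v where v: "\<forall>k<N. v k \<ge> 0"
    and sum_v: "\<forall>\<theta>\<in>\<Theta>. (\<Sum>k<N. v k * p k \<theta>) = \<theta>"
    using positive_series_finite[OF assms(1), of p w "\<lambda>\<theta>. \<theta>"] by blast
  have p_eq: "\<i> * of_real (p j \<theta>) = alt_char 1 (- int j) \<theta> + alt_char 1 (int j + 1) \<theta>" for j \<theta>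
  proof -
    define a where "a = \<theta> * (real j + 1 / 2)"
    have "alt_char 1 (- int j) \<theta> = cis (- (pi * real j) + a)"
      by (simp add: alt_char_def a_def algebra_simps)
    moreover have "alt_char 1 (int j + 1) \<theta> = cis ((pi * real j + pi) + (- a))"
      by (simp add: alt_char_def a_def algebra_simps)
    ultimately have "alt_char 1 (- int j) \<theta> + alt_char 1 (int j + 1) \<theta> = 
       cis (- (pi * real j)) * cis a + cis (pi * real j) * cis pi * cis (- a)"
      by (simp only: cis_mult)
    moreover have "cis (pi * real j) = of_real ((-1) ^ j)" "cis (- (pi * real j)) = of_real ((-1) ^ j)"
      by (simp_all add: complex_eq_iff cos_npi2 sin_npi2 del: of_real_power)
    moreover have "cis a - cis (- a) = \<i> * of_real (2 * sin a)"
      by (simp add: complex_eq_iff)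
    moreover have "p j \<theta> = 2 * (-1) ^ j * sin a"
      by (simp only: p_def a_def)
    ultimately show ?thesis
      by (simp add: algebra_simps)
  qed
  have "(\<lambda>\<theta>. \<Sum>j<M. of_real (v j) * (\<i> * of_real (p j \<theta>))) \<in> alt_cone 1" if "M \<le> N" for M
    using that
  proof (induction M)
    case 0
    show ?case by (simp add: alt_cone.zero)
  next
    case (Suc M)
    then have "v M \<ge> 0" using v by auto
    with Suc alt_cone.add_char[OF alt_cone.add_char[of _ 1 "v M" "- int M"], of _ "v M" "int M + 1"]
    show ?case
      by (simp add: p_eq distrib_left add.assoc)
  qed
  then have "(\<lambda>\<theta>. \<Sum>j<N. of_real (v j) * (\<i> * of_real (p j \<theta>))) \<in> alt_cone 1"
    by simp
  moreover have "(\<Sum>j<N. of_real (v j) * (\<i> * of_real (p j \<theta>))) = \<i> * of_real \<theta>" if "\<theta> \<in> \<Theta>" for \<theta>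
  proof -
    have "(\<Sum>j<N. of_real (v j) * (\<i> * of_real (p j \<theta>))) = \<i> * of_real (\<Sum>j<N. v j * p j \<theta>)"
      by (simp add: sum_distrib_left mult_ac)
    then show ?thesis using sum_v that by simp
  qed
  ultimately show ?thesis
    by (intro bexI[of _ "\<lambda>\<theta>. \<Sum>j<N. of_real (v j) * (\<i> * of_real (p j \<theta>))"] ballI)
qed

text \<open>The \<open>n\<close>-th power of the first-order sum already has the right values and
  nonnegative weights. It may be long, and Caratheodory's theorem shortens it.\<close>

lemma nth_order_finite_sum:
  assumes \<Theta>: "finite \<Theta>" "\<forall>\<theta>\<in>\<Theta>. \<bar>\<theta>\<bar> \<le> pi" "\<forall>\<theta>\<in>\<Theta>. - \<theta> \<in> \<Theta>" and "pi \<in> \<Theta>"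
  shows "\<exists>F w. finite F \<and> card F \<le> card \<Theta> - 1 \<and> (\<forall>k\<in>F. w k \<ge> 0) \<and>
           (\<forall>\<theta>\<in>\<Theta>. (\<Sum>k\<in>F. of_real (w k) * alt_char n k \<theta>) = (\<i> * of_real \<theta>) ^ n)"
proof -
  obtain c where "c \<in> alt_cone 1" and c: "\<forall>\<theta>\<in>\<Theta>. c \<theta> = \<i> * of_real \<theta>"
    using first_order_alt_cone[OF \<Theta>(1,2)] by blast
  from alt_cone_finite_sum[OF alt_cone_power[OF this(1), of n]] obtain F w where
    F: "finite F" "\<forall>k. w k \<ge> 0"
    and w: "\<And>\<theta>. c \<theta> ^ n = (\<Sum>k\<in>F. of_real (w k) * alt_char n k \<theta>)"
    by blast
  \<comment> \<open>By conjugate symmetry the real parts at \<open>\<theta> \<ge> 0\<close> and the imaginary parts at \<open>\<theta> < 0\<close> determine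
    everything. At \<open>\<theta> = \<plusminus>\<pi>\<close> the terms do not depend on \<open>k\<close>, so that preserving the total weight
    suffices there.\<close>
  define I where "I = \<Theta> - {- pi}"
  have I: "finite I" "card I = card \<Theta> - 1"
    using assms by (auto simp: I_def)
  define p where "p k \<theta> = (if \<theta> = pi then 1 else if \<theta> \<ge> 0 then Re (alt_char n k \<theta>)
     else Im (alt_char n k \<theta>))" for k \<theta>
  from conic_caratheodory[OF I(1) F(1), of w p] F(2) obtain G v where
    G: "G \<subseteq> F" "card G \<le> card I" "\<forall>k\<in>G. v k \<ge> 0"
    and v: "\<forall>\<theta>\<in>I. (\<Sum>k\<in>G. v k * p k \<theta>) = (\<Sum>k\<in>F. w k * p k \<theta>)"
    by blast
  define SG where "SG \<theta> = (\<Sum>k\<in>G. of_real (v k) * alt_char n k \<theta>)" for \<theta>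
  define SF where "SF \<theta> = (\<Sum>k\<in>F. of_real (w k) * alt_char n k \<theta>)" for \<theta>
  have minus: "SG (- \<theta>) = cnj (SG \<theta>)" "SF (- \<theta>) = cnj (SF \<theta>)" for \<theta>
    by (simp_all add: SG_def SF_def alt_char_minus)
  have nonneg: "SG \<theta> = SF \<theta>" if "\<theta> \<in> \<Theta>" "\<theta> \<ge> 0" for \<theta>
  proof (cases "\<theta> = pi")
    case True
    have "pi \<in> I"
      using assms pi_gt_zero by (auto simp: I_def)
    with v have "(\<Sum>k\<in>G. v k) = (\<Sum>k\<in>F. w k)"
      by (force simp: p_def)
    then show ?thesis
      using True by (simp add: SG_def SF_def alt_char_pi flip: sum_distrib_right of_real_sum)
  next
    case False
    have "\<theta> \<noteq> - pi"
      using that(2) pi_gt_zero by linarith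
    then have "\<theta> \<in> I"
      using that by (simp add: I_def)
    with v False that have "(\<Sum>k\<in>G. v k * Re (alt_char n k \<theta>)) = (\<Sum>k\<in>F. w k * Re (alt_char n k \<theta>))"
      by (force simp: p_def)
    then have Re_eq: "Re (SG \<theta>) = Re (SF \<theta>)"
      by (simp add: SG_def SF_def)
    \<comment> \<open>The imaginary part is recorded by the equation at \<open>- \<theta>\<close>.
      At 0 only the real part is recorded, but there the imaginary part vanishes.\<close>
    have "Im (SG (- \<theta>)) = Im (SF (- \<theta>))"
    proof (cases "\<theta> = 0")
      case True
      then show ?thesis by (simp add: SG_def SF_def Im_alt_char_0)
    next
      case nz: False
      have "- \<theta> \<in> I"
        using that \<Theta>(3) False by (auto simp: I_def)
      then have "(\<Sum>k\<in>G. v k * p k (- \<theta>)) = (\<Sum>k\<in>F. w k * p k (- \<theta>))"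
        using v by blast
      moreover have "- \<theta> \<noteq> pi"
        using that(2) pi_gt_zero by linarith
      then have "p k (- \<theta>) = Im (alt_char n k (- \<theta>))" for k
        using nz that by (auto simp: p_def)
      ultimately show ?thesis
        by (simp add: SG_def SF_def)
    qed
    then show ?thesis
      using Re_eq by (simp add: minus complex_eq_iff)
  qed
  have "SG \<theta> = SF \<theta>" if "\<theta> \<in> \<Theta>" for \<theta>
  proof (cases "\<theta> \<ge> 0")
    case False
    then have "SG (- (- \<theta>)) = SF (- (- \<theta>))"
      unfolding minus[of "- \<theta>"] using nonneg[of "- \<theta>"] that \<Theta>(3) by simp
    then show ?thesis by simp
  qed (use nonneg that in simp)
  then have "SG \<theta> = (\<i> * of_real \<theta>) ^ n" if "\<theta> \<in> \<Theta>" for \<theta>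
    using that w[of \<theta>] c by (simp add: SF_def)
  then show ?thesis
    using G I F by (intro exI[of _ G] exI[of _ v]) (auto simp: SG_def intro: finite_subset)
qed

subsection \<open>Shift rules\<close>

text \<open>The Fourier transform of the measure, that is, the eigenvalue of the rule on the
  character of frequency \<open>\<xi>\<close>.\<close>

definition symbol :: "shift_rule \<Rightarrow> real \<Rightarrow> complex" where
  "symbol \<phi> \<xi> = (\<Sum>a\<in>Poly_Mapping.keys \<phi>. of_real (Poly_Mapping.lookup \<phi> a) * cis (- (2 * pi * \<xi> * a)))"

lemma norm_symbol_le_cost: "norm (symbol \<phi> \<xi>) \<le> cost \<phi>"
proof -
  have "norm (symbol \<phi> \<xi>) \<le>
      (\<Sum>a\<in>Poly_Mapping.keys \<phi>. norm (of_real (Poly_Mapping.lookup \<phi> a) * cis (- (2 * pi * \<xi> * a))))"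
    unfolding symbol_def by (rule norm_sum)
  then show ?thesis
    by (simp add: cost_def norm_mult)
qed

section \<open>The action of rules and derivatives on trigonometric sums\<close>

lemma in_fun_space_iff:
  "f \<in> fun_space \<Xi> \<longleftrightarrow> (\<exists>b. (\<forall>\<xi>\<in>\<Xi>. b (- \<xi>) = cnj (b \<xi>)) \<and>
     (\<forall>x. complex_of_real (f x) = (\<Sum>\<xi>\<in>\<Xi>. b \<xi> * cis (2 * pi * \<xi> * x))))"
  by (simp add: fun_space_def cis_conv_exp mult_ac)

lemma of_real_deriv_trig_sum:
  assumes h: "\<And>x. complex_of_real (h x) = (\<Sum>\<xi>\<in>\<Xi>. b \<xi> * cis (2 * pi * \<xi> * x))"
  shows "complex_of_real (deriv h x) =
           (\<Sum>\<xi>\<in>\<Xi>. b \<xi> * (2 * of_real pi * \<i> * of_real \<xi>) * cis (2 * pi * \<xi> * x))"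
proof -
  define D where "D = (\<Sum>\<xi>\<in>\<Xi>. b \<xi> * (2 * of_real pi * \<i> * of_real \<xi>) * cis (2 * pi * \<xi> * x))"
  have cis: "((\<lambda>x. cis (2 * pi * \<xi> * x)) has_vector_derivative
      (2 * of_real pi * \<i> * of_real \<xi>) * cis (2 * pi * \<xi> * x)) (at x)" for \<xi>
    unfolding cis_conv_exp
    by (rule derivative_eq_intros has_vector_derivative_real_field | simp add: mult_ac)+
  have "((\<lambda>x. \<Sum>\<xi>\<in>\<Xi>. b \<xi> * cis (2 * pi * \<xi> * x)) has_vector_derivative D) (at x)"
    unfolding D_def mult.assoc[of "b _"]
    by (intro has_vector_derivative_sum has_vector_derivative_mult_right cis)
  then have D: "((\<lambda>x. complex_of_real (h x)) has_vector_derivative D) (at x)"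
    by (simp add: h)
  have "(h has_vector_derivative Re D) (at x)"
    using bounded_linear.has_vector_derivative[OF bounded_linear_Re D] by simp
  then have "deriv h x = Re D"
    by (intro DERIV_imp_deriv) (simp add: has_real_derivative_iff_has_vector_derivative)
  \<comment> \<open>The curve is real-valued, so its imaginary part is constantly 0 and has
    derivative 0.\<close>
  moreover have "((\<lambda>x. 0) has_vector_derivative Im D) (at x)"
    using bounded_linear.has_vector_derivative[OF bounded_linear_Im D] by simp
  then have "Im D = 0"
    using vector_derivative_unique_at has_vector_derivative_const by blast
  ultimately show ?thesis
    by (simp add: D_def[symmetric] complex_eq_iff)
qed

lemma of_real_iterated_deriv_trig_sum:
  assumes h: "\<And>x. complex_of_real (h x) = (\<Sum>\<xi>\<in>\<Xi>. b \<xi> * cis (2 * pi * \<xi> * x))"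
  shows "complex_of_real ((deriv ^^ n) h x) =
           (\<Sum>\<xi>\<in>\<Xi>. b \<xi> * (2 * of_real pi * \<i> * of_real \<xi>) ^ n * cis (2 * pi * \<xi> * x))"
proof (induction n arbitrary: x)
  case 0
  show ?case by (simp add: h)
next
  case (Suc n)
  from of_real_deriv_trig_sum[OF this] show ?case
    by (simp add: mult_ac)
qed

lemma of_real_shift_apply_trig_sum:
  assumes h: "\<And>x. complex_of_real (h x) = (\<Sum>\<xi>\<in>\<Xi>. b \<xi> * cis (2 * pi * \<xi> * x))"
  shows "complex_of_real (shift_apply \<phi> h x) = (\<Sum>\<xi>\<in>\<Xi>. b \<xi> * symbol \<phi> \<xi> * cis (2 * pi * \<xi> * x))"
proof -
  have "complex_of_real (shift_apply \<phi> h x) = (\<Sum>a\<in>Poly_Mapping.keys \<phi>. \<Sum>\<xi>\<in>\<Xi>.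
      of_real (Poly_Mapping.lookup \<phi> a) * (b \<xi> * cis (2 * pi * \<xi> * (x - a))))"
    by (simp add: shift_apply_def h sum_distrib_left)
  also have "\<dots> = (\<Sum>\<xi>\<in>\<Xi>. \<Sum>a\<in>Poly_Mapping.keys \<phi>.
      of_real (Poly_Mapping.lookup \<phi> a) * (b \<xi> * cis (2 * pi * \<xi> * (x - a))))"
    by (rule sum.swap)
  also have "\<dots> = (\<Sum>\<xi>\<in>\<Xi>. b \<xi> * symbol \<phi> \<xi> * cis (2 * pi * \<xi> * x))"
  proof (rule sum.cong)
    fix \<xi>
    have "cis (2 * pi * \<xi> * (x - a)) = cis (- (2 * pi * \<xi> * a)) * cis (2 * pi * \<xi> * x)" for a
      by (simp add: cis_mult algebra_simps)
    then show "(\<Sum>a\<in>Poly_Mapping.keys \<phi>. of_real (Poly_Mapping.lookup \<phi> a) *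
        (b \<xi> * cis (2 * pi * \<xi> * (x - a)))) = b \<xi> * symbol \<phi> \<xi> * cis (2 * pi * \<xi> * x)"
      by (simp add: symbol_def sum_distrib_left sum_distrib_right mult_ac)
  qed simp
  finally show ?thesis .
qed

lemma feasibleI_symbol:
  assumes "\<And>\<xi>. \<xi> \<in> \<Xi> \<Longrightarrow> symbol \<phi> \<xi> = (2 * of_real pi * \<i> * of_real \<xi>) ^ \<alpha>"
  shows "feasible \<Xi> \<alpha> \<phi>"
  unfolding feasible_def
proof (intro ballI ext)
  fix g x assume "g \<in> fun_space \<Xi>"
  then obtain b where g: "\<And>x. complex_of_real (g x) = (\<Sum>\<xi>\<in>\<Xi>. b \<xi> * cis (2 * pi * \<xi> * x))"
    unfolding in_fun_space_iff by blast
  have "complex_of_real (shift_apply \<phi> g x) = complex_of_real ((deriv ^^ \<alpha>) g x)"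
    unfolding of_real_shift_apply_trig_sum[OF g] of_real_iterated_deriv_trig_sum[OF g]
    by (intro sum.cong) (simp_all add: assms)
  then show "shift_apply \<phi> g x = (deriv ^^ \<alpha>) g x"
    using of_real_eq_iff by blast
qed

lemma feasible_symbol:
  assumes \<Xi>: "finite \<Xi>" "symmetric_set \<Xi>" and "\<xi> \<in> \<Xi>" and "feasible \<Xi> \<alpha> \<phi>"
  shows "symbol \<phi> \<xi> = (2 * of_real pi * \<i> * of_real \<xi>) ^ \<alpha>"
proof -
  define T where "T \<eta> = (2 * of_real pi * \<i> * complex_of_real \<eta>) ^ \<alpha>" for \<eta>
  define E where "E = symbol \<phi> \<xi> - T \<xi>"
  \<comment> \<open>A sum of two conditionals covers \<open>\<xi> = 0\<close> too, where both
    contributions fall on the same frequency.\<close>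
  define b where "b \<eta> = (if \<eta> = \<xi> then cnj E / 2 else 0) + (if \<eta> = - \<xi> then E / 2 else 0)" for \<eta>
  define g where "g x = Re (cnj E * cis (2 * pi * \<xi> * x))" for x
  have "- \<xi> \<in> \<Xi>"
    using assms by (auto simp: symmetric_set_def)
  have sum_b: "(\<Sum>\<eta>\<in>\<Xi>. b \<eta> * f \<eta>) = cnj E / 2 * f \<xi> + E / 2 * f (- \<xi>)" for f
  proof -
    have "(\<Sum>\<eta>\<in>\<Xi>. b \<eta> * f \<eta>) = (\<Sum>\<eta>\<in>\<Xi>. (if \<eta> = \<xi> then cnj E / 2 * f \<xi> else 0) +
        (if \<eta> = - \<xi> then E / 2 * f (- \<xi>) else 0))"
      by (intro sum.cong) (auto simp: b_def distrib_right)
    then show ?thesis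
      using \<Xi>(1) \<open>\<xi> \<in> \<Xi>\<close> \<open>- \<xi> \<in> \<Xi>\<close> by (simp add: sum.distrib sum.delta)
  qed
  have Re_eq: "complex_of_real (Re z) = z / 2 + cnj z / 2" for z
    by (simp add: complex_eq_iff)
  have g: "complex_of_real (g x) = (\<Sum>\<eta>\<in>\<Xi>. b \<eta> * cis (2 * pi * \<eta> * x))" for x
    unfolding sum_b g_def Re_eq by (simp add: cis_cnj)
  have "b (- \<eta>) = cnj (b \<eta>)" for \<eta>
    by (auto simp: b_def)
  with g have "g \<in> fun_space \<Xi>"
    unfolding in_fun_space_iff by blast
  then have "shift_apply \<phi> g 0 = (deriv ^^ \<alpha>) g 0"
    using assms by (simp add: feasible_def)
  then have "complex_of_real (shift_apply \<phi> g 0) = complex_of_real ((deriv ^^ \<alpha>) g 0)"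
    by simp
  then have "(\<Sum>\<eta>\<in>\<Xi>. b \<eta> * symbol \<phi> \<eta>) = (\<Sum>\<eta>\<in>\<Xi>. b \<eta> * T \<eta>)"
    unfolding of_real_shift_apply_trig_sum[OF g] of_real_iterated_deriv_trig_sum[OF g]
    by (simp add: T_def)
  moreover have "symbol \<phi> (- \<xi>) = cnj (symbol \<phi> \<xi>)"
    by (simp add: symbol_def cis_cnj)
  moreover have "T (- \<xi>) = cnj (T \<xi>)"
    by (simp add: T_def)
  ultimately have "cnj E / 2 * symbol \<phi> \<xi> + E / 2 * cnj (symbol \<phi> \<xi>) =
      cnj E / 2 * T \<xi> + E / 2 * cnj (T \<xi>)"
    unfolding sum_b by simp
  moreover have "cnj E * E + cnj (cnj E * E) = 2 * ((cnj E / 2 * symbol \<phi> \<xi> +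
      E / 2 * cnj (symbol \<phi> \<xi>)) - (cnj E / 2 * T \<xi> + E / 2 * cnj (T \<xi>)))"
    by (simp add: E_def field_simps)
  ultimately have "cnj E * E + cnj (cnj E * E) = 0"
    by simp
  then have "Re (cnj E * E + cnj (cnj E * E)) = 0"
    by simp
  then have "2 * (Re E * Re E) + 2 * (Im E * Im E) = 0"
    by simp
  then have "Re E * Re E + Im E * Im E = 0"
    by linarith
  then have "E = 0"
    by (simp add: complex_eq_iff)
  then show ?thesis by (simp add: E_def T_def)
qed

section \<open>Construction of an optimal rule\<close>

lemma ex_shift_rule:
  assumes "finite A"
  shows "\<exists>\<phi> :: shift_rule. Poly_Mapping.keys \<phi> \<subseteq> A \<and> (\<forall>a\<in>A. Poly_Mapping.lookup \<phi> a = u a)"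
proof -
  have "finite {a. (if a \<in> A then u a else 0) \<noteq> 0}"
    using assms by (rule rev_finite_subset) auto
  then have "Poly_Mapping.lookup (Abs_poly_mapping (\<lambda>a. if a \<in> A then u a else 0)) =
      (\<lambda>a. if a \<in> A then u a else 0)"
    by (rule lookup_Abs_poly_mapping)
  then show ?thesis
    by (intro exI[of _ "Abs_poly_mapping (\<lambda>a. if a \<in> A then u a else 0)"])
      (auto simp: in_keys_iff split: if_splits)
qed

text \<open>Some prescribed weights may be 0, so the support can be smaller than the set of nodes;
  \<open>f 0 x = 0\<close> makes the extra nodes harmless.\<close>

lemma sum_keys_reindex:
  fixes \<phi> :: shift_rule
  assumes "finite F" "inj_on a F" "Poly_Mapping.keys \<phi> \<subseteq> a ` F"
    and lookup: "\<And>k. k \<in> F \<Longrightarrow> Poly_Mapping.lookup \<phi> (a k) = s k"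
    and "\<And>x. f 0 x = 0"
  shows "(\<Sum>x\<in>Poly_Mapping.keys \<phi>. f (Poly_Mapping.lookup \<phi> x) x) = (\<Sum>k\<in>F. f (s k) (a k))"
proof -
  have "(\<Sum>x\<in>Poly_Mapping.keys \<phi>. f (Poly_Mapping.lookup \<phi> x) x) =
      (\<Sum>x\<in>a ` F. f (Poly_Mapping.lookup \<phi> x) x)"
    using assms by (intro sum.mono_neutral_left) (auto simp: in_keys_iff)
  also have "\<dots> = (\<Sum>k\<in>F. f (s k) (a k))"
    by (simp add: sum.reindex[OF assms(2)] lookup)
  finally show ?thesis .
qed

text \<open>Scaling by \<open>pi / K\<close> carries the frequencies into the interval from -pi to
  pi, with \<open>K\<close> going to pi, where the cost can be read off.\<close>

lemma optimal_shift_rule_pos: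
  assumes \<Xi>: "finite \<Xi>" "symmetric_set \<Xi>" and K: "K \<in> \<Xi>" "K > 0" "\<forall>\<xi>\<in>\<Xi>. \<xi> \<le> K"
  shows "\<exists>\<phi>. feasible \<Xi> \<alpha> \<phi> \<and> cost \<phi> = (2 * pi * K) ^ \<alpha> \<and>
           card (Poly_Mapping.keys \<phi>) \<le> card \<Xi> - 1"
proof -
  define \<Theta> where "\<Theta> = (\<lambda>\<xi>. pi * \<xi> / K) ` \<Xi>"
  have sym: "- \<xi> \<in> \<Xi>" if "\<xi> \<in> \<Xi>" for \<xi>
    using that \<Xi> by (auto simp: symmetric_set_def)
  have card_\<Theta>: "card \<Theta> = card \<Xi>"
    unfolding \<Theta>_def using K by (intro card_image) (auto simp: inj_on_def)
  have "finite \<Theta>"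
    using \<Xi> by (simp add: \<Theta>_def)
  moreover have "\<forall>\<theta>\<in>\<Theta>. \<bar>\<theta>\<bar> \<le> pi"
  proof
    fix \<theta> assume "\<theta> \<in> \<Theta>"
    then obtain \<xi> where \<xi>: "\<xi> \<in> \<Xi>" "\<theta> = pi * \<xi> / K" by (auto simp: \<Theta>_def)
    have "\<xi> \<le> K" "- \<xi> \<le> K"
      using K(3) sym[OF \<xi>(1)] \<xi>(1) by blast+
    then have "\<bar>\<xi>\<bar> \<le> K" by linarith
    then show "\<bar>\<theta>\<bar> \<le> pi"
      using K by (simp add: \<xi> abs_mult divide_le_eq)
  qed
  moreover have "\<forall>\<theta>\<in>\<Theta>. - \<theta> \<in> \<Theta>"
  proof
    fix \<theta> assume "\<theta> \<in> \<Theta>"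
    then obtain \<xi> where "\<xi> \<in> \<Xi>" "\<theta> = pi * \<xi> / K" by (auto simp: \<Theta>_def)
    then have "- \<theta> = pi * (- \<xi>) / K" "- \<xi> \<in> \<Xi>"
      using sym by auto
    then show "- \<theta> \<in> \<Theta>"
      unfolding \<Theta>_def by blast
  qed
  moreover have "pi \<in> \<Theta>"
    unfolding \<Theta>_def using K by (intro image_eqI[of _ _ K]) auto
  ultimately obtain F w where F: "finite F" "card F \<le> card \<Xi> - 1" "\<forall>k\<in>F. w k \<ge> 0"
    and w: "\<forall>\<theta>\<in>\<Theta>. (\<Sum>k\<in>F. of_real (w k) * alt_char \<alpha> k \<theta>) = (\<i> * of_real \<theta>) ^ \<alpha>"
    using nth_order_finite_sum[of \<Theta> \<alpha>] unfolding card_\<Theta> by blast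
  define a where "a k = (of_int k - real \<alpha> / 2) / (2 * K)" for k :: int
  \<comment> \<open>The cosine is the sign (-1)^k that \<open>alt_char\<close> contains. The power
    of \<open>2 * K\<close> undoes the scaling of the frequencies in the derivative.\<close>
  define s where "s k = (2 * K) ^ \<alpha> * cos (pi * of_int k) * w k" for k
  have inj: "inj a"
    using K by (auto simp: inj_def a_def)
  obtain \<phi> :: shift_rule where keys: "Poly_Mapping.keys \<phi> \<subseteq> a ` F"
    and "\<forall>x\<in>a ` F. Poly_Mapping.lookup \<phi> x = s (the_inv a x)"
    using ex_shift_rule[of "a ` F" "\<lambda>x. s (the_inv a x)"] F(1) by blast
  then have lookup: "Poly_Mapping.lookup \<phi> (a k) = s k" if "k \<in> F" for k
    using that the_inv_f_f[OF inj] by simp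
  note sum_keys = sum_keys_reindex[OF F(1) inj_on_subset[OF inj subset_UNIV] keys lookup]
  have "symbol \<phi> \<xi> = (2 * of_real pi * \<i> * of_real \<xi>) ^ \<alpha>" if "\<xi> \<in> \<Xi>" for \<xi>
  proof -
    have "of_real (s k) * cis (- (2 * pi * \<xi> * a k)) =
        of_real ((2 * K) ^ \<alpha>) * (of_real (w k) * alt_char \<alpha> k (pi * \<xi> / K))" for k
    proof -
      have "alt_char \<alpha> k (pi * \<xi> / K) = cis (pi * of_int k) * cis (- (2 * pi * \<xi> * a k))"
        using K by (simp add: alt_char_def a_def cis_mult mult.assoc)
      then show ?thesis
        unfolding cis_pi_int s_def by simp
    qed
    then have "symbol \<phi> \<xi> =
        of_real ((2 * K) ^ \<alpha>) * (\<Sum>k\<in>F. of_real (w k) * alt_char \<alpha> k (pi * \<xi> / K))"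
      unfolding symbol_def
      by (subst sum_keys[where f = "\<lambda>u x. of_real u * cis (- (2 * pi * \<xi> * x))"])
        (simp_all add: sum_distrib_left)
    also have "(\<Sum>k\<in>F. of_real (w k) * alt_char \<alpha> k (pi * \<xi> / K)) = (\<i> * of_real (pi * \<xi> / K)) ^ \<alpha>"
      using w that by (simp add: \<Theta>_def)
    also have "of_real ((2 * K) ^ \<alpha>) * \<dots> = (of_real (2 * K) * (\<i> * of_real (pi * \<xi> / K))) ^ \<alpha>"
      by (simp only: of_real_power power_mult_distrib[of "of_real (2 * K)"])
    also have "of_real (2 * K) * (\<i> * of_real (pi * \<xi> / K)) = 2 * of_real pi * \<i> * of_real \<xi>"
      using K by (simp add: complex_eq_iff)
    finally show ?thesis .
  qed
  then have "feasible \<Xi> \<alpha> \<phi>"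
    by (rule feasibleI_symbol)
  moreover have "cost \<phi> = (2 * pi * K) ^ \<alpha>"
  proof -
    \<comment> \<open>At \<open>\<theta> = pi\<close> all terms share one phase, so taking norms
      yields the total weight.\<close>
    have "(\<Sum>k\<in>F. of_real (w k)) * cis (pi * real \<alpha> / 2) = (\<i> * of_real pi) ^ \<alpha>"
      using w \<open>pi \<in> \<Theta>\<close> by (auto simp: alt_char_pi sum_distrib_right)
    then have "norm (complex_of_real (\<Sum>k\<in>F. w k)) * norm (cis (pi * real \<alpha> / 2)) = norm ((\<i> * of_real pi) ^ \<alpha>)"
      unfolding of_real_sum norm_mult[symmetric] by simp
    then have "\<bar>\<Sum>k\<in>F. w k\<bar> = pi ^ \<alpha>"
      by (simp only: norm_of_real norm_cis norm_power norm_mult) simp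
    moreover have "(\<Sum>k\<in>F. w k) \<ge> 0"
      using F by (intro sum_nonneg) auto
    ultimately have "(\<Sum>k\<in>F. w k) = pi ^ \<alpha>"
      by simp
    moreover have "\<bar>s k\<bar> = (2 * K) ^ \<alpha> * w k" if "k \<in> F" for k
      using K F that by (simp add: s_def abs_mult power_abs)
    ultimately show ?thesis
      unfolding cost_def by (subst sum_keys[where f = "\<lambda>u x. \<bar>u\<bar>"])
        (simp_all add: power_mult_distrib flip: sum_distrib_left)
  qed
  moreover have "card (Poly_Mapping.keys \<phi>) \<le> card \<Xi> - 1"
    using card_mono[OF _ keys] card_image_le[OF F(1), of a] F by auto
  ultimately show ?thesis by blast
qed

theorem theorem10:
  fixes \<alpha> :: nat and \<Xi> :: "real set"
  assumes "\<alpha> \<ge> 1"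
    and "finite \<Xi>" and "\<Xi> \<noteq> {}" and "symmetric_set \<Xi>"
  shows "\<exists>\<phi> :: shift_rule. optimal \<Xi> \<alpha> \<phi> \<and>
           card (Poly_Mapping.keys \<phi>) \<le> card \<Xi> - \<alpha> mod 2"
proof -
  define K where "K = Max \<Xi>"
  have K: "K \<in> \<Xi>" "\<forall>\<xi>\<in>\<Xi>. \<xi> \<le> K"
    using assms by (auto simp: K_def)
  have sym: "- \<xi> \<in> \<Xi>" if "\<xi> \<in> \<Xi>" for \<xi>
    using that assms by (auto simp: symmetric_set_def)
  have "K \<ge> 0"
    using K sym[of K] by fastforce
  have "\<exists>\<phi>. feasible \<Xi> \<alpha> \<phi> \<and> cost \<phi> = (2 * pi * K) ^ \<alpha> \<and> card (Poly_Mapping.keys \<phi>) \<le> card \<Xi> - 1"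
  proof (cases "K > 0")
    case True
    then show ?thesis
      using optimal_shift_rule_pos assms K by blast
  next
    case False
    \<comment> \<open>Here \<open>\<Xi>\<close> contains only 0. The zero rule works, since a
      derivative of order at least 1 annihilates constants.\<close>
    with \<open>K \<ge> 0\<close> have "K = 0" by simp
    have "\<xi> = 0" if "\<xi> \<in> \<Xi>" for \<xi>
    proof -
      have "\<xi> \<le> K" "- \<xi> \<le> K"
        using K(2) that sym[OF that] by blast+
      then show ?thesis
        using \<open>K = 0\<close> by linarith
    qed
    then have "feasible \<Xi> \<alpha> 0"
      using assms(1) by (intro feasibleI_symbol) (auto simp: symbol_def)
    then show ?thesis
      using \<open>K = 0\<close> assms(1) by (intro exI[of _ 0]) (auto simp: cost_def)
  qed
  then obtain \<phi> where \<phi>: "feasible \<Xi> \<alpha> \<phi>" "cost \<phi> = (2 * pi * K) ^ \<alpha>"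
    "card (Poly_Mapping.keys \<phi>) \<le> card \<Xi> - 1"
    by blast
  \<comment> \<open>Bernstein's argument: feasibility fixes the symbol at \<open>K\<close>, whose
    modulus (2 pi K)^\<alpha> is at most the cost.\<close>
  have "cost \<phi> \<le> cost \<psi>" if "feasible \<Xi> \<alpha> \<psi>" for \<psi>
    using norm_symbol_le_cost[of \<psi> K] feasible_symbol[OF assms(2,4) K(1) that] \<phi>(2) \<open>K \<ge> 0\<close>
    by (simp add: norm_mult norm_power)
  then have "(INF \<psi>\<in>{\<psi>. feasible \<Xi> \<alpha> \<psi>}. cost \<psi>) = cost \<phi>"
    using \<phi>(1) by (intro cInf_eq_minimum) auto
  moreover have "card \<Xi> - 1 \<le> card \<Xi> - \<alpha> mod 2"
    by (intro diff_le_mono2) (simp add: mod_less_eq_dividend less_Suc_eq_le[symmetric])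
  ultimately show ?thesis
    using \<phi> by (auto simp: optimal_def)
qed

end
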